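(* If $n\geq 2$ is even and $\mathcal T$ is chosen uniformly at random from $\overline{\mathsf D}\mathsf{FBPT}_{n-1}$, then \[\mathbb E(\mathrm{des}(\mathcal P(\mathcal T))+1)=\left(1-\frac{E_n}{nE_{n-1}}\right)n\sim\left(1-\frac{2}{\pi}\right)n,\] where the asymptotic statement is as $n\to\infty$ through even integers.
   Context: A binary plane tree is a finite rooted tree in which every vertex has at most two children, every child is designated as either a left child or a right child (not both), and no vertex has two left children or two right children. It is full if it is nonempty and every vertex has either $0$ or $2$ children. $\overline{\mathsf D}\mathsf{FBPT}_{m}$ is the set of full binary plane trees with $m$ vertices whose vertices are bijectively labeled with $1,\dots,m$ so that every nonroot vertex has a smaller label than its parent. The postorder reading $\mathcal P$ is defined recursively: $\mathcal P$ of the empty tree is the empty permutation, and $\mathcal P(\mathcal T)=\mathcal P(\mathcal T_L)\,\mathcal P(\mathcal T_R)\,m$ if $\mathcal T$ has root label $m$ and left and right subtrees $\mathcal T_L,\mathcal T_R$. $\mathrm{des}(\pi)$ is the number of indices $i$ with $\pi_i>\pi_{i+1}$. The Euler numbers $E_n$ are defined by $\sum_{n\ge0}E_n\frac{z^n}{n!}=\sec(z)+\tan(z)$. *)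

theory Defs
  imports
    "HOL-Probability.Probability"
    "HOL-Library.Tree"
    "HOL-Library.Landau_Symbols"
    "HOL-Computational_Algebra.Formal_Power_Series"
begin

text \<open>
  A binary plane tree with vertices labeled by elements of \<open>'a\<close> is an \<open>'a tree\<close>: the vertices are
  the \<^const>\<open>Node\<close>s, and \<^const>\<open>Leaf\<close> is the empty tree, i.e. an absent child, not a vertex.
  Accordingly \<^const>\<open>size\<close> is the number of vertices and \<^const>\<open>set_tree\<close> the set of labels.
  The postorder reading is the library's \<^const>\<open>postorder\<close>.
\<close>

definition full_tree :: "'a tree \<Rightarrow> bool" where
  "full_tree t \<longleftrightarrow> t \<noteq> Leaf \<and> (\<forall>l a r. Node l a r \<in> subtrees t \<longrightarrow> (l = Leaf \<longleftrightarrow> r = Leaf))"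

definition decreasing_tree :: "'a::linorder tree \<Rightarrow> bool" where
  "decreasing_tree t \<longleftrightarrow>
     (\<forall>l a r. Node l a r \<in> subtrees t \<longrightarrow> (\<forall>c\<in>{l, r}. c \<noteq> Leaf \<longrightarrow> value c < a))"

text \<open>
  Since \<open>m\<close> vertices carry all of the labels \<open>1, \<dots>, m\<close>, the labeling is bijective.
\<close>
definition DFBPT :: "nat \<Rightarrow> nat tree set" where
  "DFBPT m = {t. full_tree t \<and> decreasing_tree t \<and> size t = m \<and> set_tree t = {1..m}}"

definition des :: "'a::linorder list \<Rightarrow> nat" where
  "des p = card {i. Suc i < length p \<and> p ! i > p ! Suc i}"

text \<open>
  \<open>\<Sum>\<^sub>n E\<^sub>n z\<^sup>n / n! = sec z + tan z\<close>, as an identity of formal power series.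
\<close>
definition euler_number :: "nat \<Rightarrow> real" where
  "euler_number n = fact n * fps_nth (inverse (fps_cos 1) + fps_tan 1) n"

text \<open>
  The uniform distribution \<^term>\<open>pmf_of_set A\<close> is meaningful only for finite nonempty \<open>A\<close>.
\<close>

lemma finite_DFBPT: "finite (DFBPT m)"
proof -
  have *: "finite {t :: nat tree. size t \<le> k \<and> set_tree t \<subseteq> {1..m}}" for k
  proof (induction k)
    case 0
    have "{t :: nat tree. size t \<le> 0 \<and> set_tree t \<subseteq> {1..m}} \<subseteq> {Leaf}" by auto
    then show ?case by (rule finite_subset) simp
  next
    case (Suc k)
    let ?S = "{t :: nat tree. size t \<le> k \<and> set_tree t \<subseteq> {1..m}}"
    have "t \<in> insert Leaf ((\<lambda>(l, a, r). Node l a r) ` (?S \<times> {1..m} \<times> ?S))"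
      if "size t \<le> Suc k" "set_tree t \<subseteq> {1..m}" for t :: "nat tree"
      using that by (cases t) (auto simp: image_iff)
    then have "{t :: nat tree. size t \<le> Suc k \<and> set_tree t \<subseteq> {1..m}}
        \<subseteq> insert Leaf ((\<lambda>(l, a, r). Node l a r) ` (?S \<times> {1..m} \<times> ?S))"
      by blast
    then show ?case by (rule finite_subset) (use Suc in auto)
  qed
  show ?thesis
    by (rule finite_subset[OF _ *[of m]]) (auto simp: DFBPT_def)
qed

lemma DFBPT_nonempty:
  assumes "odd m"
  shows "DFBPT m \<noteq> {}"
proof -
  have "DFBPT (2 * k + 1) \<noteq> {}" for k
  proof (induction k)
    case 0
    have "Node Leaf 1 Leaf \<in> DFBPT (2 * 0 + 1)"
      by (auto simp: DFBPT_def full_tree_def decreasing_tree_def)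
    then show ?case by blast
  next
    case (Suc k)
    then obtain t where t: "t \<in> DFBPT (2 * k + 1)" by blast
    then obtain l a r where lar: "t = Node l a r"
      by (cases t) (auto simp: DFBPT_def full_tree_def)
    have "a \<in> {1..2 * k + 1}" using t lar by (auto simp: DFBPT_def)
    then have a: "a < 2 * k + 3" by simp
    have S: "{1..Suc (Suc (Suc (2 * k)))} = {1..2 * k + 1} \<union> {2 * k + 2, 2 * k + 3}" by auto
    have "Node t (2 * k + 3) (Node Leaf (2 * k + 2) Leaf) \<in> DFBPT (2 * Suc k + 1)"
      using t a lar unfolding DFBPT_def full_tree_def decreasing_tree_def
      by (auto simp: S)
    then show ?case by blast
  qed
  with assms show ?thesis by (auto elim!: oddE)
qed

end

theory Submission
  imports Defs "HOL-Complex_Analysis.Complex_Analysis"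
begin

text \<open>
  Let \<open>m = n - 1\<close>, which is odd. A word of length \<open>m\<close> has \<open>m - 1\<close> adjacent positions, so
  \<open>des + 1 = n - (asc + 1)\<close>, and the exact formula says that \<open>asc + 1\<close> has expectation
  \<open>E\<^sub>n / E\<^sub>m\<close> in the postorder reading of a random tree. The trees are counted by the tangent number
  \<open>E\<^sub>m\<close> (lemma \<open>card_decreasing_full_trees\<close>), so it remains to show that the total of \<open>asc + 1\<close> over
  all trees is \<open>E\<^sub>n\<close> (lemma \<open>sum_nondes\<close>).

  At a vertex with nonempty subtrees \<open>l\<close> and \<open>r\<close> the statistic \<open>asc + 1\<close> is the sum of its values on \<open>l\<close> and
  \<open>r\<close>, plus one if the root of \<open>l\<close> is smaller than the leftmost leaf of \<open>r\<close>. Call such a pair linked.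
  With exponential generating functions \<open>T\<close> of the trees, \<open>B\<close> of the linked pairs and \<open>S\<close> of the total
  of the statistic, deleting the maximal label yields
  \<open>T' = 1 + T\<^sup>2\<close>, \<open>B' = T (1 + B)\<close> and \<open>S' = 1 + 2 T S + B\<close>, whence \<open>T = tan\<close>, \<open>B = sec - 1\<close> and
  \<open>S = tan \<cdot> sec = sec'\<close>. The coefficient of \<open>z\<^sup>m / m!\<close> in \<open>sec'\<close> is \<open>E\<^sub>n\<close>.

  For the asymptotics, \<open>sec + tan\<close> has a single pole in the disc of radius \<open>3 \<pi> / 2\<close>, a simple one
  at \<open>\<pi> / 2\<close>. Therefore \<open>E\<^sub>n / n!\<close> is asymptotic to a constant multiple of \<open>(2 / \<pi>)\<^sup>n\<close>, and
  \<open>E\<^sub>n / (n E\<^bsub>n-1\<^esub>)\<close> tends to \<open>2 / \<pi>\<close> (lemma \<open>euler_number_ratio_limit\<close>).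
\<close>

unbundle no vec_syntax and fps_syntax

section \<open>Decreasing full trees on a set of labels\<close>

lemma full_tree_Leaf [simp]: "\<not> full_tree Leaf"
  by (simp add: full_tree_def)

lemma full_tree_Node:
  "full_tree (Node l a r) \<longleftrightarrow> (l = Leaf \<and> r = Leaf) \<or> (full_tree l \<and> full_tree r)"
  unfolding full_tree_def by (cases "l = Leaf"; cases "r = Leaf") fastforce+

lemma decreasing_tree_Leaf [simp]: "decreasing_tree Leaf"
  by (simp add: decreasing_tree_def)

lemma decreasing_tree_Node:
  "decreasing_tree (Node l a r) \<longleftrightarrow>
     (l \<noteq> Leaf \<longrightarrow> value l < a) \<and> (r \<noteq> Leaf \<longrightarrow> value r < a) \<and>
     decreasing_tree l \<and> decreasing_tree r"
  unfolding decreasing_tree_def by auto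

lemma decreasing_tree_le_value:
  "decreasing_tree t \<Longrightarrow> x \<in> set_tree t \<Longrightarrow> x \<le> value t"
proof (induction t)
  case (Node l a r)
  then show ?case
    by (cases "l = Leaf"; cases "r = Leaf") (fastforce simp: decreasing_tree_Node)+
qed simp

lemma decreasing_tree_Node_iff:
  "decreasing_tree (Node l a r) \<longleftrightarrow>
     (\<forall>x\<in>set_tree l \<union> set_tree r. x < a) \<and> decreasing_tree l \<and> decreasing_tree r"
proof -
  have *: "(\<forall>x\<in>set_tree t. x < a) \<longleftrightarrow> (t \<noteq> Leaf \<longrightarrow> value t < a)" if "decreasing_tree t" for t
    using decreasing_tree_le_value[OF that] by (cases t) (auto intro: le_less_trans)
  show ?thesis
    unfolding decreasing_tree_Node ball_Un using * by blast
qed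

text \<open>
  Arbitrary label sets make the recursion at the root stay inside the family: the two subtrees of a
  tree on \<open>{1..m}\<close> carry complementary label sets that are no longer initial segments. All counts
  below turn out to depend on the label set only through its cardinality, so no relabeling is ever
  performed.
\<close>
definition decreasing_full_trees :: "'a::linorder set \<Rightarrow> 'a tree set" where
  "decreasing_full_trees A =
     {t. full_tree t \<and> decreasing_tree t \<and> distinct (postorder t) \<and> set_tree t = A}"

lemma DFBPT_eq: "DFBPT m = decreasing_full_trees {1..m}"
proof -
  have "size t = card (set_tree t) \<longleftrightarrow> distinct (postorder t)" for t :: "nat tree"
    using distinct_card[of "postorder t"] card_distinct[of "postorder t"]
    by (auto simp: size1_size)
  then have "set_tree t = {1..m} \<Longrightarrow> size t = m \<longleftrightarrow> distinct (postorder t)" for t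
    by (metis card_atLeastAtMost diff_Suc_1)
  then show ?thesis
    unfolding DFBPT_def decreasing_full_trees_def by blast
qed

lemma decreasing_full_trees_empty [simp]: "decreasing_full_trees {} = {}"
  by (auto simp: decreasing_full_trees_def)

lemma decreasing_full_trees_insert_Max:
  assumes "\<forall>x\<in>A. x < M"
  shows "decreasing_full_trees (insert M A) =
           (if A = {} then {Node Leaf M Leaf} else {}) \<union>
           (\<lambda>(X, l, r). Node l M r) `
             (SIGMA X:Pow A. decreasing_full_trees X \<times> decreasing_full_trees (A - X))"
    (is "_ = ?R")
proof (intro equalityI subsetI)
  fix t assume t: "t \<in> decreasing_full_trees (insert M A)"
  then obtain l a r where lar: "t = Node l a r"
    by (cases t) (auto simp: decreasing_full_trees_def)
  have lt: "\<forall>x\<in>set_tree l \<union> set_tree r. x < a"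
    and lab: "insert a (set_tree l \<union> set_tree r) = insert M A"
    using t by (auto simp: decreasing_full_trees_def lar decreasing_tree_Node_iff)
  have "a = M"
    using lt lab assms by (metis (no_types, lifting) insertE insertI1 less_asym)
  with lt assms have "M \<notin> set_tree l \<union> set_tree r" "M \<notin> A"
    by auto
  with lab \<open>a = M\<close> have A: "set_tree l \<union> set_tree r = A"
    by (simp add: insert_ident)
  have "set_tree r = A - set_tree l"
    using t A by (auto simp: decreasing_full_trees_def lar)
  show "t \<in> ?R"
  proof (cases "l = Leaf \<and> r = Leaf")
    case True
    then show ?thesis using A \<open>a = M\<close> by (auto simp: lar)
  next
    case False
    then have "l \<in> decreasing_full_trees (set_tree l)"
      "r \<in> decreasing_full_trees (A - set_tree l)"
      using t A \<open>set_tree r = _\<close>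
      by (auto simp: decreasing_full_trees_def lar full_tree_Node decreasing_tree_Node_iff)
    then show ?thesis
      using A \<open>a = M\<close> by (auto simp: lar image_iff intro!: bexI[of _ "set_tree l"])
  qed
next
  fix t assume "t \<in> ?R"
  then show "t \<in> decreasing_full_trees (insert M A)"
  proof (elim UnE imageE)
    assume "t \<in> (if A = {} then {Node Leaf M Leaf} else {})"
    then show ?thesis
      by (auto simp: decreasing_full_trees_def full_tree_Node decreasing_tree_Node_iff
          split: if_splits)
  next
    fix p assume p: "t = (\<lambda>(X, l, r). Node l M r) p"
      "p \<in> (SIGMA X:Pow A. decreasing_full_trees X \<times> decreasing_full_trees (A - X))"
    then obtain X l r where "p = (X, l, r)" "X \<subseteq> A" "l \<in> decreasing_full_trees X"
      "r \<in> decreasing_full_trees (A - X)"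
      by auto
    moreover have "M \<notin> A"
      using assms by blast
    ultimately show ?thesis
      using p(1) assms
      by (auto simp: decreasing_full_trees_def full_tree_Node decreasing_tree_Node_iff)
  qed
qed

section \<open>Sums over trees by the label sets of the two subtrees\<close>

text \<open>
  Removing the largest label removes the root of a decreasing tree, and the subtrees below it may
  carry any subset of the remaining labels; this is the matching induction on label sets.
\<close>
lemma finite_subset_max_induct [consumes 1, case_names empty insert]:
  fixes A :: "'a::linorder set"
  assumes "finite A" "P {}"
    and "\<And>M A. finite A \<Longrightarrow> \<forall>x\<in>A. x < M \<Longrightarrow> (\<And>X. X \<subseteq> A \<Longrightarrow> P X) \<Longrightarrow> P (insert M A)"
  shows "P A"
  using assms(1)
proof (induction A rule: finite_psubset_induct)
  case (psubset A)
  show ?case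
  proof (cases "A = {}")
    case False
    let ?M = "Max A"
    have "P (insert ?M (A - {?M}))"
    proof (rule assms(3))
      show "\<forall>x\<in>A - {?M}. x < ?M"
        using psubset.hyps by (auto simp: less_le)
      show "P X" if "X \<subseteq> A - {?M}" for X
        using that psubset False by (intro psubset.IH) (auto dest: Max_in)
    qed (use psubset in auto)
    then show ?thesis
      using psubset.hyps False by (simp add: insert_absorb)
  qed (use assms in simp)
qed

lemma finite_decreasing_full_trees: "finite A \<Longrightarrow> finite (decreasing_full_trees A)"
proof (induction A rule: finite_subset_max_induct)
  case (insert M A)
  then show ?case
    by (auto simp: decreasing_full_trees_insert_Max intro!: finite_imageI finite_SigmaI)
qed simp

lemma sum_decreasing_full_trees_insert_Max:
  fixes w :: "'a::linorder tree \<Rightarrow> real"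
  assumes "finite A" and M: "\<forall>x\<in>A. x < M"
  shows "sum w (decreasing_full_trees (insert M A)) =
           (if A = {} then w (Node Leaf M Leaf) else 0) +
           (\<Sum>X\<in>Pow A. \<Sum>l\<in>decreasing_full_trees X. \<Sum>r\<in>decreasing_full_trees (A - X).
              w (Node l M r))"
proof -
  let ?S = "SIGMA X:Pow A. decreasing_full_trees X \<times> decreasing_full_trees (A - X)"
  have fin: "finite (decreasing_full_trees X)" if "X \<subseteq> A" for X
    using that assms finite_decreasing_full_trees finite_subset by blast
  have finS: "finite ?S"
    using assms(1) fin by (intro finite_SigmaI finite_cartesian_product) auto
  have inj: "inj_on (\<lambda>(X, l, r). Node l M r) ?S"
    by (auto simp: inj_on_def decreasing_full_trees_def)
  have "sum w (decreasing_full_trees (insert M A)) =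
          (if A = {} then w (Node Leaf M Leaf) else 0) +
          sum w ((\<lambda>(X, l, r). Node l M r) ` ?S)"
    using finS
    by (subst decreasing_full_trees_insert_Max[OF M], subst sum.union_disjoint)
       auto
  also have "sum w ((\<lambda>(X, l, r). Node l M r) ` ?S) = (\<Sum>(X, l, r)\<in>?S. w (Node l M r))"
    by (subst sum.reindex[OF inj]) (simp add: case_prod_unfold)
  also have "\<dots> = (\<Sum>X\<in>Pow A. \<Sum>(l, r)\<in>decreasing_full_trees X \<times> decreasing_full_trees (A - X).
                    w (Node l M r))"
    using assms(1) fin by (subst sum.Sigma) (auto simp: case_prod_unfold)
  also have "\<dots> = (\<Sum>X\<in>Pow A. \<Sum>l\<in>decreasing_full_trees X. \<Sum>r\<in>decreasing_full_trees (A - X).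
                    w (Node l M r))"
    by (simp add: sum.cartesian_product)
  finally show ?thesis .
qed

text \<open>
  The product formula for exponential generating functions: splitting a label set in two in all
  possible ways is multiplication of the generating functions.
\<close>
lemma sum_Pow_card_fps:
  fixes F G :: "real fps"
  assumes "finite A"
  shows "(\<Sum>X\<in>Pow A. (fact (card X) * F $ card X) * (fact (card (A - X)) * G $ card (A - X)))
       = fact (card A) * (F * G) $ card A"
proof -
  let ?n = "card A"
  let ?h = "\<lambda>k. (fact k * F $ k) * (fact (?n - k) * G $ (?n - k))"
  have "(\<Sum>X\<in>Pow A. (fact (card X) * F $ card X) * (fact (card (A - X)) * G $ card (A - X)))
      = (\<Sum>X\<in>Pow A. ?h (card X))"
    using assms by (intro sum.cong) (auto simp: card_Diff_subset finite_subset)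
  also have "\<dots> = (\<Sum>k\<le>?n. \<Sum>X\<in>{X \<in> Pow A. card X = k}. ?h (card X))"
    using assms by (intro sum.group[symmetric]) (auto intro: card_mono)
  also have "\<dots> = (\<Sum>k\<le>?n. real (?n choose k) * ?h k)"
    using n_subsets[OF assms] by (intro sum.cong) auto
  also have "\<dots> = (\<Sum>k\<le>?n. fact ?n * (F $ k * G $ (?n - k)))"
    by (intro sum.cong refl) (simp add: binomial_fact)
  also have "\<dots> = fact ?n * (F * G) $ ?n"
    by (simp add: fps_mult_nth sum_distrib_left atMost_atLeast0)
  finally show ?thesis .
qed

text \<open>
  Ordered splittings into three blocks \<open>X\<close>, \<open>Y\<close> and a rest are grouped by \<open>Z = X \<union> Y\<close>.
\<close>
lemma sum_Pow_Diff_swap: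
  assumes "finite A"
  shows "(\<Sum>X\<in>Pow A. \<Sum>Y\<in>Pow (A - X). f X Y) = (\<Sum>Z\<in>Pow A. \<Sum>X\<in>Pow Z. f X (Z - X))"
proof -
  have fin: "finite X" if "X \<subseteq> A" for X
    using that assms finite_subset by blast
  have "(\<Sum>X\<in>Pow A. \<Sum>Y\<in>Pow (A - X). f X Y) = (\<Sum>(X, Y)\<in>(SIGMA X:Pow A. Pow (A - X)). f X Y)"
    using assms by (subst sum.Sigma) auto
  also have "\<dots> = (\<Sum>(Z, X)\<in>(SIGMA Z:Pow A. Pow Z). f X (Z - X))"
    by (rule sum.reindex_bij_witness[where i = "\<lambda>(Z, X). (X, Z - X)" and j = "\<lambda>(X, Y). (X \<union> Y, X)"])
       (auto intro!: arg_cong2[where f = f])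
  also have "\<dots> = (\<Sum>Z\<in>Pow A. \<Sum>X\<in>Pow Z. f X (Z - X))"
    using assms fin by (subst sum.Sigma) auto
  finally show ?thesis .
qed

section \<open>Descents of the postorder reading\<close>

lemma des_Cons_Cons: "des (x # y # zs) = of_bool (x > y) + des (y # zs)"
proof -
  let ?d = "\<lambda>p. {i. Suc i < length p \<and> p ! i > p ! Suc i}"
  have fin: "finite (?d p)" for p :: "'a list"
    by (rule finite_subset[of _ "{..<length p}"]) auto
  have "?d (x # y # zs) = (if x > y then {0} else {}) \<union> Suc ` ?d (y # zs)"
  proof (rule set_eqI)
    fix i show "i \<in> ?d (x # y # zs) \<longleftrightarrow> i \<in> (if x > y then {0} else {}) \<union> Suc ` ?d (y # zs)"
      by (cases i) (auto simp: image_iff)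
  qed
  then show ?thesis
    using fin[of "y # zs"] by (auto simp: des_def card_image)
qed

lemma des_single [simp]: "des [x] = 0"
  by (simp add: des_def)

lemma des_append:
  "xs \<noteq> [] \<Longrightarrow> ys \<noteq> [] \<Longrightarrow> des (xs @ ys) = des xs + des ys + of_bool (last xs > hd ys)"
proof (induction xs rule: induct_list012)
  case (2 x)
  then show ?case by (cases ys) (auto simp: des_Cons_Cons)
qed (auto simp: des_Cons_Cons)

lemma last_postorder: "t \<noteq> Leaf \<Longrightarrow> last (postorder t) = value t"
  by (cases t) auto

lemma postorder_eq_Nil [simp]: "postorder t = [] \<longleftrightarrow> t = Leaf"
  by (cases t) auto

lemma hd_postorder_in_set_tree: "t \<noteq> Leaf \<Longrightarrow> hd (postorder t) \<in> set_tree t"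
  using hd_in_set[of "postorder t"] by simp

lemma value_in_set_tree: "t \<noteq> Leaf \<Longrightarrow> value t \<in> set_tree t"
  by (cases t) auto

text \<open>
  For sibling subtrees \<open>l\<close> and \<open>r\<close>, whose readings are adjacent in that order, this detects an
  ascent at the seam: the reading of \<open>l\<close> ends with its root and that of \<open>r\<close> starts with its leftmost
  leaf.
\<close>
definition linked :: "'a::linorder tree \<Rightarrow> 'a tree \<Rightarrow> real" where
  "linked l r = of_bool (value l < hd (postorder r))"

text \<open>
  One plus the number of ascents of the reading, which has an additive recursion without constant
  term at the internal vertices.
\<close>
definition nondes :: "'a::linorder tree \<Rightarrow> real" where
  "nondes t = real (size t) - real (des (postorder t))"

lemma nondes_single [simp]: "nondes (Node Leaf x Leaf) = 1"
  by (simp add: nondes_def)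

text \<open>
  The reading is that of \<open>l\<close>, then that of \<open>r\<close>, then \<open>M\<close>. The last step into \<open>M\<close> is an ascent
  because \<open>M\<close> is maximal, which makes up for counting the extra one for both \<open>l\<close> and \<open>r\<close>; only the
  step from \<open>l\<close> to \<open>r\<close> remains.
\<close>
lemma nondes_Node:
  assumes "l \<in> decreasing_full_trees X" "r \<in> decreasing_full_trees Y" "X \<inter> Y = {}"
    and M: "\<forall>x\<in>X \<union> Y. x < M"
  shows "nondes (Node l M r) = nondes l + nondes r + linked l r"
proof -
  have ne: "l \<noteq> Leaf" "r \<noteq> Leaf" and lab: "set_tree l = X" "set_tree r = Y"
    using assms by (auto simp: decreasing_full_trees_def)
  have "value l \<noteq> hd (postorder r)"
    using hd_postorder_in_set_tree[of r] value_in_set_tree[of l] ne lab assms(3) by auto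
  moreover have "\<not> value r > M"
    using value_in_set_tree[of r] M lab ne by (auto simp: not_less intro: less_imp_le)
  ultimately show ?thesis
    using ne by (auto simp: nondes_def linked_def des_append last_postorder)
qed

section \<open>Tangent and secant generating functions\<close>

lemma fps_nth_Suc_deriv: "fact (Suc n) * F $ Suc n = fact n * fps_deriv F $ n"
  for F :: "real fps"
  by (simp add: algebra_simps)

lemma fps_tan_deriv_eq: "fps_deriv (fps_tan 1) = 1 + fps_tan 1 * (fps_tan 1 :: real fps)"
proof -
  let ?c = "fps_cos (1::real)" and ?s = "fps_sin (1::real)"
  have "fps_deriv (fps_tan 1) = inverse ?c * inverse ?c * 1"
    by (simp add: fps_tan_deriv fps_divide_unit power2_eq_square fps_inverse_mult)
  also have "1 = ?c * ?c + ?s * ?s"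
    by (simp flip: fps_sin_cos_sum_of_squares[of 1] power2_eq_square)
  also have "inverse ?c * inverse ?c * (?c * ?c + ?s * ?s) =
      (inverse ?c * ?c) * (inverse ?c * ?c) + ?s * inverse ?c * (?s * inverse ?c)"
    by (simp add: algebra_simps)
  also have "inverse ?c * ?c = 1"
    by (simp add: inverse_mult_eq_1)
  finally show ?thesis
    by (simp add: fps_tan_def fps_divide_unit)
qed

lemma fps_sec_deriv:
  "fps_deriv (inverse (fps_cos 1)) = fps_tan 1 * inverse (fps_cos (1::real))"
  by (simp add: fps_inverse_deriv fps_cos_deriv fps_tan_def fps_divide_unit power2_eq_square
      flip: fps_const_neg)

text \<open>
  Root decomposition turns into \<open>T' = 1 + T\<^sup>2\<close>, the differential equation of the tangent.
\<close>
lemma card_decreasing_full_trees: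
  fixes A :: "'a::linorder set"
  assumes "finite A"
  shows "real (card (decreasing_full_trees A)) = fact (card A) * fps_tan 1 $ card A"
  using assms
proof (induction A rule: finite_subset_max_induct)
  case empty
  then show ?case by (simp add: fps_tan_def)
next
  case (insert M A)
  let ?T = "fps_tan 1 :: real fps" and ?D = "decreasing_full_trees :: 'a set \<Rightarrow> _"
  have card_insert: "card (insert M A) = Suc (card A)"
    using insert.hyps by (intro card_insert_disjoint) auto
  have "real (card (?D (insert M A))) = (\<Sum>t\<in>?D (insert M A). 1)"
    by simp
  also have "\<dots> = of_bool (A = {}) + (\<Sum>X\<in>Pow A. real (card (?D X)) * real (card (?D (A - X))))"
    using insert by (subst sum_decreasing_full_trees_insert_Max) auto
  also have "\<dots> = of_bool (A = {}) + (\<Sum>X\<in>Pow A.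
      (fact (card X) * ?T $ card X) * (fact (card (A - X)) * ?T $ card (A - X)))"
    using insert by (intro arg_cong2[where f = "(+)"] sum.cong refl) auto
  also have "\<dots> = fact (card A) * (1 + ?T * ?T) $ card A"
    using insert.hyps by (auto simp: sum_Pow_card_fps card_gt_0_iff)
  also have "\<dots> = fact (card (insert M A)) * ?T $ card (insert M A)"
    by (simp only: card_insert fps_nth_Suc_deriv fps_tan_deriv_eq)
  finally show ?case .
qed

text \<open>
  The number of pairs of trees with complementary label sets in \<open>A\<close> for which the root of the first
  is smaller than the leftmost leaf of the second. Hanging the first tree below that leaf as a left
  child shows that these are the decreasing trees on \<open>A\<close> in which exactly one vertex has a single
  child, that child is a left one, and the vertex lies on the left spine.
\<close>
definition linked_pairs :: "'a::linorder set \<Rightarrow> real" where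
  "linked_pairs A = (\<Sum>X\<in>Pow A. \<Sum>l\<in>decreasing_full_trees X. \<Sum>r\<in>decreasing_full_trees (A - X).
     linked l r)"

text \<open>
  The maximum \<open>M\<close> has to be the root of the second tree. Either this tree is a single vertex, and
  the first one is arbitrary on \<open>A\<close>, or the left subtree of \<open>M\<close> contains the leftmost leaf and
  forms again a linked pair with the first tree, while the right subtree of \<open>M\<close> is arbitrary.
\<close>
lemma linked_pairs_insert_Max:
  fixes A :: "'a::linorder set"
  assumes A: "finite A" and M: "\<forall>x\<in>A. x < M"
  shows "linked_pairs (insert M A) = real (card (decreasing_full_trees A)) +
           (\<Sum>Z\<in>Pow A. linked_pairs Z * real (card (decreasing_full_trees (A - Z))))"
proof -
  let ?D = "decreasing_full_trees :: 'a set \<Rightarrow> _"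
  let ?I = "insert M A"
  have [simp]: "M \<notin> A" using M by blast
  \<comment> \<open>If \<open>M\<close> lies in the first tree, it is its root and no leaf of the second exceeds it.\<close>
  have root_M: "linked l r = 0" if "l \<in> ?D X" "r \<in> ?D (?I - X)" "M \<in> X" for l r X
  proof -
    have ne: "l \<noteq> Leaf" "r \<noteq> Leaf" and lab: "set_tree r = ?I - X"
      using that(1,2) by (auto simp: decreasing_full_trees_def)
    have "M \<le> value l"
      using that(1,3) by (intro decreasing_tree_le_value) (simp_all add: decreasing_full_trees_def)
    moreover have "hd (postorder r) \<in> A"
      using hd_postorder_in_set_tree[OF ne(2)] lab that(3) by auto
    ultimately show ?thesis
      using M by (auto simp: linked_def)
  qed
  have step: "(\<Sum>r\<in>?D (?I - X). linked l r) =
      of_bool (X = A) + (\<Sum>Y\<in>Pow (A - X). \<Sum>r\<in>?D Y. linked l r * real (card (?D (A - X - Y))))"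
    if X: "X \<subseteq> A" and l: "l \<in> ?D X" for X l
  proof -
    have "l \<noteq> Leaf"
      using l by (auto simp: decreasing_full_trees_def)
    then have "value l \<in> X"
      using l value_in_set_tree[of l] by (simp add: decreasing_full_trees_def)
    then have single: "linked l (Node Leaf M Leaf) = 1"
      using X M by (auto simp: linked_def)
    have "linked l (Node r1 M r2) = linked l r1" if "r1 \<in> ?D Y" for r1 r2 Y
    proof -
      have "r1 \<noteq> Leaf"
        using that by (auto simp: decreasing_full_trees_def)
      then show ?thesis
        by (simp add: linked_def)
    qed
    moreover have "?I - X = insert M (A - X)"
      using X by auto
    ultimately show ?thesis
      using A M X by (auto simp: sum_decreasing_full_trees_insert_Max single mult.commute intro!: sum.cong)
  qed
  have "linked_pairs ?I = (\<Sum>X\<in>Pow A. \<Sum>l\<in>?D X. \<Sum>r\<in>?D (?I - X). linked l r)"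
    unfolding linked_pairs_def using A root_M
    by (intro sum.mono_neutral_right) (auto intro!: sum.neutral)
  also have "\<dots> = (\<Sum>X\<in>Pow A. \<Sum>l\<in>?D X. of_bool (X = A) +
      (\<Sum>Y\<in>Pow (A - X). \<Sum>r\<in>?D Y. linked l r * real (card (?D (A - X - Y)))))"
    using step by (intro sum.cong) auto
  also have "\<dots> = (\<Sum>X\<in>Pow A. of_bool (X = A) * real (card (?D X))) +
      (\<Sum>X\<in>Pow A. \<Sum>Y\<in>Pow (A - X). \<Sum>l\<in>?D X. \<Sum>r\<in>?D Y. linked l r * real (card (?D (A - X - Y))))"
    by (subst sum.swap) (simp add: sum.distrib mult.commute)
  also have "(\<Sum>X\<in>Pow A. of_bool (X = A) * real (card (?D X))) = real (card (?D A))"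
    using A by (simp add: of_bool_def if_distrib[of "\<lambda>x. x * _"] cong: if_cong)
  also have "(\<Sum>X\<in>Pow A. \<Sum>Y\<in>Pow (A - X). \<Sum>l\<in>?D X. \<Sum>r\<in>?D Y. linked l r * real (card (?D (A - X - Y))))
     = (\<Sum>Z\<in>Pow A. \<Sum>X\<in>Pow Z. \<Sum>l\<in>?D X. \<Sum>r\<in>?D (Z - X). linked l r * real (card (?D (A - X - (Z - X)))))"
    by (rule sum_Pow_Diff_swap[OF A])
  also have "\<dots> = (\<Sum>Z\<in>Pow A. linked_pairs Z * real (card (?D (A - Z))))"
    unfolding linked_pairs_def sum_distrib_right
    by (intro sum.cong refl arg_cong2[where f = "(*)"]) (auto intro!: arg_cong[of _ _ "\<lambda>B. card (?D B)"])
  finally show ?thesis .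
qed

text \<open>
  Deleting the maximum gives \<open>B' = T (1 + B)\<close> with \<open>T = tan\<close>, which \<open>B = sec - 1\<close> solves.
\<close>
lemma linked_pairs_eq:
  fixes A :: "'a::linorder set"
  assumes "finite A"
  shows "linked_pairs A = fact (card A) * (inverse (fps_cos 1) - 1) $ card A"
  using assms
proof (induction A rule: finite_subset_max_induct)
  case empty
  then show ?case by (simp add: linked_pairs_def)
next
  case (insert M A)
  let ?T = "fps_tan 1 :: real fps" and ?D = "decreasing_full_trees :: 'a set \<Rightarrow> _"
  let ?B = "inverse (fps_cos 1) - 1 :: real fps"
  have fin: "finite X" if "X \<subseteq> A" for X
    using that insert.hyps finite_subset by blast
  have card_insert: "card (insert M A) = Suc (card A)"
    using insert.hyps by (intro card_insert_disjoint) auto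
  have "linked_pairs (insert M A) = real (card (?D A)) +
           (\<Sum>Z\<in>Pow A. linked_pairs Z * real (card (?D (A - Z))))"
    using insert by (intro linked_pairs_insert_Max) auto
  also have "\<dots> = fact (card A) * ?T $ card A + (\<Sum>Z\<in>Pow A.
      (fact (card Z) * ?B $ card Z) * (fact (card (A - Z)) * ?T $ card (A - Z)))"
    using insert fin by (simp add: card_decreasing_full_trees)
  also have "\<dots> = fact (card A) * (?T + ?B * ?T) $ card A"
    using insert.hyps by (subst sum_Pow_card_fps) (auto simp: algebra_simps)
  also have "?T + ?B * ?T = fps_deriv ?B"
    by (simp add: fps_sec_deriv algebra_simps)
  also have "fact (card A) * fps_deriv ?B $ card A = fact (card (insert M A)) * ?B $ card (insert M A)"
    by (simp only: card_insert fps_nth_Suc_deriv)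
  finally show ?case .
qed

text \<open>
  The recursion for \<^const>\<open>nondes\<close> gives \<open>S' = 1 + 2 T S + B\<close> with \<open>T = tan\<close> and \<open>B = sec - 1\<close>.
  Its solution \<open>S = tan \<cdot> sec\<close> is the derivative of the secant, hence the shift to the next Euler
  number.
\<close>
lemma sum_nondes:
  fixes A :: "'a::linorder set"
  assumes "finite A"
  shows "sum nondes (decreasing_full_trees A) =
           fact (card A) * (fps_tan 1 * inverse (fps_cos 1)) $ card A"
  using assms
proof (induction A rule: finite_subset_max_induct)
  case empty
  then show ?case by (simp add: fps_tan_def)
next
  case (insert M A)
  let ?T = "fps_tan 1 :: real fps" and ?D = "decreasing_full_trees :: 'a set \<Rightarrow> _"
  let ?Y = "inverse (fps_cos 1) :: real fps"
  let ?S = "?T * ?Y"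
  let ?N = "\<lambda>X. sum nondes (?D X)" and ?c = "\<lambda>X. real (card (?D X))"
  have fin: "finite X" if "X \<subseteq> A" for X
    using that insert.hyps finite_subset by blast
  have card_insert: "card (insert M A) = Suc (card A)"
    using insert.hyps by (intro card_insert_disjoint) auto
  have "?N (insert M A) = of_bool (A = {}) +
      (\<Sum>X\<in>Pow A. \<Sum>l\<in>?D X. \<Sum>r\<in>?D (A - X). nondes (Node l M r))"
    using insert by (subst sum_decreasing_full_trees_insert_Max) auto
  also have "\<dots> = of_bool (A = {}) +
      (\<Sum>X\<in>Pow A. \<Sum>l\<in>?D X. \<Sum>r\<in>?D (A - X). nondes l + nondes r + linked l r)"
    using insert by (intro arg_cong2[where f = "(+)"] sum.cong refl nondes_Node) auto
  also have "\<dots> = of_bool (A = {}) + (\<Sum>X\<in>Pow A. ?N X * ?c (A - X)) +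
      (\<Sum>X\<in>Pow A. ?c X * ?N (A - X)) + linked_pairs A"
    by (simp add: linked_pairs_def sum.distrib sum_distrib_left sum_distrib_right mult.commute)
  also have "(\<Sum>X\<in>Pow A. ?N X * ?c (A - X)) = fact (card A) * (?S * ?T) $ card A"
    using insert fin by (simp add: card_decreasing_full_trees sum_Pow_card_fps)
  also have "(\<Sum>X\<in>Pow A. ?c X * ?N (A - X)) = fact (card A) * (?T * ?S) $ card A"
    using insert fin by (simp add: card_decreasing_full_trees sum_Pow_card_fps)
  also have "linked_pairs A = fact (card A) * (?Y - 1) $ card A"
    using insert.hyps(1) by (rule linked_pairs_eq)
  also have "of_bool (A = {}) = fact (card A) * (1 :: real fps) $ card A"
    using insert.hyps by (auto simp: card_gt_0_iff)
  finally have "?N (insert M A) = fact (card A) * (1 + ?S * ?T + ?T * ?S + (?Y - 1)) $ card A"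
    by (simp only: fps_add_nth distrib_left)
  also have "1 + ?S * ?T + ?T * ?S + (?Y - 1) = (1 + ?T ^ 2) * ?Y + ?T * (?T * ?Y)"
    by (simp add: algebra_simps power2_eq_square)
  also have "\<dots> = fps_deriv ?S"
    by (simp add: fps_sec_deriv fps_tan_deriv_eq power2_eq_square algebra_simps)
  also have "fact (card A) * fps_deriv ?S $ card A = fact (card (insert M A)) * ?S $ card (insert M A)"
    by (simp only: card_insert fps_nth_Suc_deriv)
  finally show ?case .
qed

section \<open>The expected number of descents\<close>

text \<open>
  The secant is even and the tangent is odd, so each Euler number sees only one of the two.
\<close>
lemma euler_number_odd: "odd n \<Longrightarrow> euler_number n = fact n * fps_tan 1 $ n"
  and euler_number_even: "even n \<Longrightarrow> euler_number n = fact n * inverse (fps_cos 1) $ n"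
proof -
  have neg: "(F oo (- fps_X)) $ n = (- 1) ^ n * F $ n" for F :: "real fps"
    by (simp add: fps_compose_uminus')
  have cos_neg: "fps_cos 1 oo (- fps_X) = (fps_cos 1 :: real fps)"
    by (simp add: fps_compose_uminus' fps_cos_def fps_eq_iff)
  have sin_neg: "fps_sin 1 oo (- fps_X) = - (fps_sin 1 :: real fps)"
    by (simp add: fps_compose_uminus' fps_sin_def fps_eq_iff)
  have sec_neg: "inverse (fps_cos 1) oo (- fps_X) = inverse (fps_cos 1 :: real fps)"
    using cos_neg by (subst fps_inverse_compose) auto
  have tan_neg: "fps_tan 1 oo (- fps_X) = - (fps_tan 1 :: real fps)"
    by (simp add: fps_tan_def fps_divide_unit fps_compose_mult_distrib sec_neg sin_neg)
  show "odd n \<Longrightarrow> euler_number n = fact n * fps_tan 1 $ n"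
    using neg[of "inverse (fps_cos 1)"] by (simp add: sec_neg euler_number_def)
  show "even n \<Longrightarrow> euler_number n = fact n * inverse (fps_cos 1) $ n"
    using neg[of "fps_tan 1"] by (simp add: tan_neg euler_number_def)
qed

lemma expectation_des_DFBPT:
  assumes "n \<ge> 2" "even n"
  shows "measure_pmf.expectation (pmf_of_set (DFBPT (n - 1))) (\<lambda>T. real (des (postorder T)) + 1) =
    (1 - euler_number n / (real n * euler_number (n - 1))) * real n"
proof -
  define m where "m = n - 1"
  have n: "n = Suc m" and "odd m"
    using assms by (auto simp: m_def)
  let ?D = "DFBPT m"
  have ne: "?D \<noteq> {}" and fin: "finite ?D"
    using \<open>odd m\<close> by (simp_all add: DFBPT_nonempty finite_DFBPT)
  have card: "real (card ?D) = euler_number m"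
    using \<open>odd m\<close> by (simp add: DFBPT_eq card_decreasing_full_trees euler_number_odd)
  have "sum nondes ?D = fact m * fps_deriv (inverse (fps_cos 1)) $ m"
    by (simp add: DFBPT_eq sum_nondes fps_sec_deriv)
  also have "\<dots> = euler_number n"
    using assms by (simp only: euler_number_even n fps_nth_Suc_deriv)
  finally have nondes: "sum nondes ?D = euler_number n" .
  have "real (des (postorder t)) + 1 = real n - nondes t" if "t \<in> ?D" for t
    using that by (simp add: DFBPT_def nondes_def n)
  then have "(\<Sum>t\<in>?D. real (des (postorder t)) + 1) = real n * euler_number m - euler_number n"
    by (simp add: sum_subtractf card nondes)
  then have "measure_pmf.expectation (pmf_of_set ?D) (\<lambda>T. real (des (postorder T)) + 1) =
      (real n * euler_number m - euler_number n) / euler_number m"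
    using ne fin by (simp add: integral_pmf_of_set card)
  moreover have "euler_number m \<noteq> 0"
    using card ne fin by (metis card_0_eq of_nat_eq_0_iff)
  ultimately show ?thesis
    unfolding m_def[symmetric] using assms by (simp add: diff_divide_distrib left_diff_distrib)
qed

section \<open>Asymptotics of the Euler numbers\<close>

definition complex_sinc :: "complex \<Rightarrow> complex" where
  "complex_sinc z = (if z = 0 then 1 else sin z / z)"

lemma complex_sinc_holomorphic: "complex_sinc holomorphic_on UNIV"
proof (rule no_isolated_singularity'[where K = "{0}"])
  show "(complex_sinc \<longlongrightarrow> complex_sinc z) (at z within UNIV)" if "z \<in> {0}" for z
  proof -
    have "((\<lambda>z. sin z / z) \<longlongrightarrow> 1) (at (0::complex))"
      using DERIV_sin[of "0::complex"] by (simp add: DERIV_def)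
    moreover have "\<forall>\<^sub>F z in at 0. sin z / z = complex_sinc z"
      by (simp add: eventually_at_filter complex_sinc_def)
    ultimately show ?thesis
      using that by (auto simp: complex_sinc_def intro: Lim_transform_eventually)
  qed
  have "(\<lambda>z. sin z / z) holomorphic_on UNIV - {0}"
    by (auto intro!: holomorphic_intros)
  then show "complex_sinc holomorphic_on UNIV - {0}"
    by (rule holomorphic_transform) (auto simp: complex_sinc_def)
qed auto

lemma complex_sinc_nonzero:
  assumes "norm z < pi"
  shows "complex_sinc z \<noteq> 0"
proof
  assume "complex_sinc z = 0"
  then have "z \<noteq> 0" "sin z = 0"
    by (auto simp: complex_sinc_def split: if_splits)
  then obtain k :: int where k: "z = of_real (k * pi)" "k \<noteq> 0"
    unfolding sin_eq_0 by fastforce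
  then have "norm z = of_int \<bar>k\<bar> * pi"
    by (simp add: abs_mult norm_mult)
  moreover have "real_of_int \<bar>k\<bar> \<ge> 1"
    using k(2) by linarith
  ultimately have "norm z \<ge> 1 * pi"
    by (metis mult_right_mono pi_ge_zero)
  then show False using assms by simp
qed

text \<open>
  The function \<open>f z = (\<pi> / 2 - z) (sec z + tan z)\<close>. In terms of \<open>w = (\<pi> / 2 - z) / 2\<close> the identity
  \<open>sec z + tan z = cot w\<close> gives \<open>f z = 2 cos w / (sin w / w)\<close>, and \<open>\<bar>w\<bar> < \<pi>\<close> as long as
  \<open>\<bar>z\<bar> < 3 \<pi> / 2\<close>; so \<open>\<pi> / 2\<close> is the only pole in this disc and it has been removed.
\<close>
lemma sec_plus_tan_pole_removed:
  obtains f :: "complex \<Rightarrow> complex" where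
    "f holomorphic_on ball 0 (3 * pi / 2)" "f (pi / 2) = 2"
    "\<And>z :: complex. z \<in> ball 0 (3 * pi / 2) \<Longrightarrow> f z * cos z = (pi / 2 - z) * (1 + sin z)"
proof
  let ?w = "\<lambda>z::complex. (pi / 2 - z) / 2"
  let ?f = "\<lambda>z. 2 * cos (?w z) / complex_sinc (?w z)"
  have nz: "complex_sinc (?w z) \<noteq> 0" if "z \<in> ball 0 (3 * pi / 2)" for z :: complex
  proof (rule complex_sinc_nonzero)
    have "norm (?w z) = norm (of_real (pi / 2) - z) / 2"
      by (simp add: norm_divide)
    also have "\<dots> \<le> (norm (of_real (pi / 2) :: complex) + norm z) / 2"
      by (intro divide_right_mono norm_triangle_ineq4) auto
    also have "\<dots> < pi"
      using that by (simp only: norm_of_real) simp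
    finally show "norm (?w z) < pi" .
  qed
  have "(\<lambda>z. complex_sinc (?w z)) holomorphic_on ball 0 (3 * pi / 2)"
    by (intro holomorphic_on_compose_gen[OF _ complex_sinc_holomorphic, of ?w, unfolded o_def]
        holomorphic_intros) auto
  then show "?f holomorphic_on ball 0 (3 * pi / 2)"
    using nz by (intro holomorphic_intros) auto
  show "?f (pi / 2) = 2"
    by (simp add: complex_sinc_def)
  show "?f z * cos z = (pi / 2 - z) * (1 + sin z)" if "z \<in> ball 0 (3 * pi / 2)" for z :: complex
  proof -
    let ?v = "?w z"
    have "of_real pi / 2 - z = 2 * ?v"
      by simp
    then have "cos z = sin (2 * ?v)" "sin z = cos (2 * ?v)"
      by (simp_all only: cos_sin_eq[of z] sin_cos_eq[of z])
    then have cs: "cos z = 2 * sin ?v * cos ?v" "1 + sin z = 2 * cos ?v ^ 2"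
      by (simp_all only: sin_double cos_double_cos) simp
    have "?v * complex_sinc ?v = sin ?v"
      by (simp add: complex_sinc_def)
    have "?f z * cos z = 4 * ?v * cos ?v ^ 2"
    proof -
      have "2 * c / k * (2 * s * c) = 4 * v * c ^ 2" if "v * k = s" "k \<noteq> 0" for c k s v :: complex
        using that(2) by (simp add: power2_eq_square flip: that(1))
      then show ?thesis
        unfolding cs using \<open>?v * complex_sinc ?v = sin ?v\<close> nz[OF that] by blast
    qed
    also have "4 * ?v * cos ?v ^ 2 = (pi / 2 - z) * (1 + sin z)"
      unfolding cs(2) by simp
    finally show ?thesis .
  qed
qed

text \<open>
  Multiplying a power series with coefficients \<open>y\<^sub>n\<close> by \<open>r - z\<close> makes the partial sums at \<open>z = r\<close>
  telescope to \<open>y\<^sub>n r\<^bsup>n+1\<^esup>\<close>. For \<open>r = \<pi> / 2\<close> and \<open>y = sec + tan\<close> the product continues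
  holomorphically beyond \<open>r\<close>, so the partial sums converge to its value there.
\<close>
lemma fps_sec_plus_tan_coeff_limit:
  "(\<lambda>n. (inverse (fps_cos 1) + fps_tan 1 :: real fps) $ n * (pi / 2) ^ Suc n) \<longlonglongrightarrow> 2"
proof -
  let ?y = "inverse (fps_cos 1) + fps_tan 1 :: real fps"
  let ?C = "fps_cos 1 :: complex fps" and ?S = "fps_sin 1 :: complex fps"
  \<comment> \<open>The real series is moved to the complex numbers through \<open>Y cos = 1 + sin\<close>.\<close>
  define Y :: "complex fps" where "Y = Abs_fps (\<lambda>n. of_real (?y $ n))"
  define L :: "complex fps" where "L = fps_const (of_real (pi / 2)) - fps_X"
  have "?y * fps_cos 1 = inverse (fps_cos 1) * fps_cos 1 + fps_sin 1 * (inverse (fps_cos 1) * fps_cos 1)"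
    by (simp add: fps_tan_def fps_divide_unit algebra_simps)
  also have "inverse (fps_cos 1) * fps_cos 1 = (1 :: real fps)"
    by (simp add: inverse_mult_eq_1)
  finally have y: "?y * fps_cos 1 = 1 + fps_sin 1"
    by simp
  have Y: "Y * ?C = 1 + ?S"
  proof (rule fps_ext)
    fix n
    have C: "?C $ k = of_real (fps_cos 1 $ k)" and S: "?S $ k = of_real (fps_sin 1 $ k)" for k
      by (simp_all add: fps_cos_def fps_sin_def)
    have "(Y * ?C) $ n = of_real ((?y * fps_cos 1) $ n)"
      by (simp only: fps_mult_nth Y_def C of_real_sum of_real_mult fps_nth_Abs_fps)
    also have "\<dots> = (1 + ?S) $ n"
      unfolding y by (simp add: S)
    finally show "(Y * ?C) $ n = (1 + ?S) $ n" .
  qed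
  obtain f :: "complex \<Rightarrow> complex" where
    f: "f holomorphic_on ball 0 (3 * pi / 2)" "f (pi / 2) = 2"
      "\<And>z :: complex. z \<in> ball 0 (3 * pi / 2) \<Longrightarrow> f z * cos z = (pi / 2 - z) * (1 + sin z)"
    using sec_plus_tan_pole_removed by blast
  define F where "F = fps_expansion f 0"
  have F: "f has_fps_expansion F"
    unfolding F_def using f(1) by (intro has_fps_expansion_fps_expansion) auto
  have "(\<lambda>z. f z * cos z) has_fps_expansion F * ?C"
    by (intro fps_expansion_intros F)
  moreover have "(\<lambda>z. f z * cos z) has_fps_expansion L * (1 + ?S)"
  proof (rule has_fps_expansion_cong[THEN iffD2, OF _ refl])
    show "\<forall>\<^sub>F z in nhds (0 :: complex). f z * cos z = (pi / 2 - z) * (1 + sin z)"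
      unfolding eventually_nhds using f(3) by (intro exI[of _ "ball 0 (3 * pi / 2)"]) auto
    show "(\<lambda>z. (pi / 2 - z) * (1 + sin z)) has_fps_expansion L * (1 + ?S)"
      unfolding L_def by (intro fps_expansion_intros)
  qed
  ultimately have "F * ?C = L * (1 + ?S)"
    by (rule fps_expansion_unique_complex)
  also have "\<dots> = L * Y * ?C"
    by (simp add: Y mult.assoc)
  finally have "F * ?C = (L * Y) * ?C" .
  moreover have "?C \<noteq> 0"
    by (metis fps_cos_nth_0 fps_zero_nth zero_neq_one)
  ultimately have FLY: "F = L * Y"
    by simp
  have partial: "(\<Sum>k\<le>n. F $ k * (pi / 2) ^ k) = of_real (?y $ n * (pi / 2) ^ Suc n)" for n
  proof (induction n)
    case 0
    then show ?case by (simp add: FLY L_def Y_def algebra_simps)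
  next
    case (Suc n)
    have "F $ Suc n = of_real (pi / 2 * ?y $ Suc n - ?y $ n)"
      by (simp add: FLY L_def Y_def algebra_simps)
    then show ?case
      by (simp only: sum.atMost_Suc Suc flip: of_real_mult of_real_add of_real_power)
         (simp add: algebra_simps)
  qed
  have "(\<lambda>k. F $ k * (pi / 2) ^ k) sums f (pi / 2)"
    using has_fps_expansion_imp_sums_complex[OF F, of "ereal (3 * pi / 2)" "of_real (pi / 2)"] f(1)
    by simp
  then have "(\<lambda>n. of_real (?y $ n * (pi / 2) ^ Suc n) :: complex) \<longlonglongrightarrow> of_real 2"
    by (simp only: sums_def_le partial f(2) of_real_numeral)
  then show ?thesis
    by (simp only: tendsto_of_real_iff)
qed

lemma euler_number_ratio_limit:
  "(\<lambda>n. euler_number (Suc n) / (real (Suc n) * euler_number n)) \<longlonglongrightarrow> 2 / pi"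
proof -
  let ?y = "inverse (fps_cos 1) + fps_tan 1 :: real fps"
  let ?q = "\<lambda>n. ?y $ n * (pi / 2) ^ Suc n"
  have "(\<lambda>n. ?q (Suc n) / ?q n * (2 / pi)) \<longlonglongrightarrow> 2 / 2 * (2 / pi)"
    using fps_sec_plus_tan_coeff_limit LIMSEQ_Suc[OF fps_sec_plus_tan_coeff_limit]
    by (intro tendsto_intros) auto
  moreover have "?q (Suc n) / ?q n * (2 / pi) = euler_number (Suc n) / (real (Suc n) * euler_number n)" for n
  proof -
    \<comment> \<open>Holds for \<open>b = 0\<close> as well, where both sides are \<open>0\<close>.\<close>
    have "a * x ^ Suc (Suc n) / (b * x ^ Suc n) * (1 / x) = a / b" if "x \<noteq> 0" for a b x :: real
      using that by (cases "b = 0") (simp_all add: field_simps)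
    from this[of "pi / 2" "?y $ Suc n" "?y $ n"]
    have "?q (Suc n) / ?q n * (2 / pi) = ?y $ Suc n / ?y $ n"
      by (simp del: fps_add_nth power_Suc)
    also have "\<dots> = (real (Suc n) * fact n * ?y $ Suc n) / (real (Suc n) * fact n * ?y $ n)"
      by (subst mult_divide_mult_cancel_left) (simp_all del: of_nat_Suc)
    finally show ?thesis
      unfolding euler_number_def fact_Suc by (simp only: mult.assoc of_nat_mult of_nat_fact)
  qed
  ultimately show ?thesis
    by simp
qed

lemma expectation_asymp_equiv:
  "(\<lambda>n::nat. (1 - euler_number n / (real n * euler_number (n - 1))) * real n)
     \<sim>[sequentially] (\<lambda>n. (1 - 2 / pi) * real n)"
proof -
  have lim: "(\<lambda>n. 1 - euler_number n / (real n * euler_number (n - 1))) \<longlonglongrightarrow> 1 - 2 / pi"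
    by (rule LIMSEQ_imp_Suc) (use euler_number_ratio_limit in \<open>auto intro: tendsto_intros\<close>)
  have "1 - 2 / pi \<noteq> 0"
    using pi_gt3 by (simp add: field_simps)
  then show ?thesis
    by (intro asymp_equiv_intros tendsto_imp_asymp_equiv_const lim)
qed

lemma asymp_equiv_filter_le:
  assumes "f \<sim>[F] g" "G \<le> F"
  shows "f \<sim>[G] g"
  using assms unfolding asymp_equiv_def by (rule tendsto_mono[rotated])

theorem theorem7p15:
  shows "(\<forall>n::nat. n \<ge> 2 \<and> even n \<longrightarrow>
            measure_pmf.expectation (pmf_of_set (DFBPT (n - 1)))
              (\<lambda>T. real (des (postorder T)) + 1)
            = (1 - euler_number n / (real n * euler_number (n - 1))) * real n)
         \<and> (\<lambda>n::nat. (1 - euler_number n / (real n * euler_number (n - 1))) * real n)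
             \<sim>[inf at_top (principal {n. even n})]
           (\<lambda>n. (1 - 2 / pi) * real n)"
proof (intro conjI allI impI)
  show "measure_pmf.expectation (pmf_of_set (DFBPT (n - 1)))
          (\<lambda>T. real (des (postorder T)) + 1)
        = (1 - euler_number n / (real n * euler_number (n - 1))) * real n"
    if "n \<ge> 2 \<and> even n" for n
    using that by (intro expectation_des_DFBPT) auto
  show "(\<lambda>n::nat. (1 - euler_number n / (real n * euler_number (n - 1))) * real n)
          \<sim>[inf at_top (principal {n. even n})] (\<lambda>n. (1 - 2 / pi) * real n)"
    by (rule asymp_equiv_filter_le[OF expectation_asymp_equiv]) simp
qed

end
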